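(* Let $\sigma$ be a derangement of $[n]$, and let $S=[s_1,\dots,s_n]$ be the inductive strategy with $s_n=\sigma$, i.e. $s_k=[2,3,\dots,k,1]$ for $1\le k\le n-1$ (with $s_1=[1]$) and $s_n=\sigma$. Let $D=d(\sigma^{-1})$ be the displacement vector of $\sigma^{-1}$. Assume that $2$ is not an entry of $D$ and that $D$ has at least one entry in $\{3,\dots,n-2\}$. Define a permutation $\omega$ of $[n]$ as follows. (1) Let $\mu$ be the minimum of the entries of $D$ that are different from $1$, let $\iota=\min\{x\in[n] : D[x]=\mu\}$, and let $K=\{\iota+k : 1\le k\le \mu-1\}$, where positions are taken modulo $n$ in $\{1,\dots,n\}$. (2) For each $i\in K$, put $\omega[i]=\sigma^{-1}[i]$. (3) Write $[n]\setminus K=\{L[1]<L[2]<\dots<L[m]\}$, where $m=n-|K|$, and for each $1\le j\le m$ put $\omega[L[j+2]]=\sigma^{-1}[L[j]]$, where the index $j+2$ is taken modulo $m$ in $\{1,\dots,m\}$. Then $\omega$ is an offending permutation for $S$.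
   Context: Permutations are written in one-line notation, $\pi=[\pi[1],\dots,\pi[n]]$, and $[n]=\{1,\dots,n\}$. A derangement is a permutation without fixed points. For a permutation $\pi$ of $[n]$, the displacement vector $d(\pi)$ is the list of length $n$ with $d(\pi)[i]=\pi[i]-i$ reduced modulo $n$ to an element of $\{0,1,\dots,n-1\}$. A strategy of length $n$ is a list $S=[s_1,\dots,s_n]$ where $s_i$ is a permutation of $[i]$ for each $1\le i\le n$. Game of permutation wordle with strategy $S$ and secret permutation $p$ of $[n]$: the first guess is the identity $\gamma_1=[1,2,\dots,n]$. For a guess $\gamma_k$, let $\mathcal{I}_k=\{m\in[n] : \gamma_k[m]\ne p[m]\}$ be the set of incorrect positions. If $\mathcal{I}_k=\emptyset$ the game ends. Otherwise write $\mathcal{I}_k=\{P_1<P_2<\dots<P_r\}$ with $r=|\mathcal{I}_k|$; the next guess $\gamma_{k+1}$ is defined by $\gamma_{k+1}[m]=\gamma_k[m]$ for $m\notin\mathcal{I}_k$ and $\gamma_{k+1}[P_{s_r(i)}]=\gamma_k[P_i]$ for $1\le i\le r$. (In particular, if $\mathcal{I}_1=[n]$ then $\gamma_2=s_n^{-1}$.) The game may be infinite. The game repeats (duplicates) incorrect information if there are guesses $\gamma_s,\gamma_t$ of the game with $s<t$ and a position $m\in\mathcal{I}_s$ such that $\gamma_s[m]=\gamma_t[m]$. A permutation $\omega$ of $[n]$ is an offending permutation for $S$ if the game played with strategy $S$ and secret permutation $\omega$ repeats incorrect information. *)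

theory Defs
  imports "HOL-Combinatorics.Permutations"
begin

text \<open>
  A permutation of \<open>[n]\<close> is a function \<open>\<pi> :: nat \<Rightarrow> nat\<close> with \<open>\<pi> permutes {1..n}\<close>; in particular
  it is the identity outside \<open>{1..n}\<close>. Positions, values and ranks are counted from 1.
\<close>

definition derangement :: "nat \<Rightarrow> (nat \<Rightarrow> nat) \<Rightarrow> bool" where
  "derangement n \<pi> \<longleftrightarrow> \<pi> permutes {1..n} \<and> (\<forall>i\<in>{1..n}. \<pi> i \<noteq> i)"

text \<open>The list entry \<open>displacement n \<pi> ! (i - 1)\<close> is the displacement at position \<open>i\<close>.\<close>

definition displacement :: "nat \<Rightarrow> (nat \<Rightarrow> nat) \<Rightarrow> nat list" where
  "displacement n \<pi> = map (\<lambda>i. nat ((int (\<pi> i) - int i) mod int n)) [1..<Suc n]"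

text \<open>The \<open>i\<close>-th smallest element of a finite set, for \<open>1 \<le> i \<le> card A\<close>.\<close>

definition nth_least :: "nat set \<Rightarrow> nat \<Rightarrow> nat" where
  "nth_least A i = sorted_list_of_set A ! (i - 1)"

text \<open>The representative of \<open>x \<ge> 1\<close> modulo \<open>m\<close> in \<open>{1..m}\<close>.\<close>

definition wrap :: "nat \<Rightarrow> nat \<Rightarrow> nat" where
  "wrap m x = (x - 1) mod m + 1"

text \<open>A strategy \<open>[s\<^sub>1, \<dots>, s\<^sub>n]\<close> is a list, so that \<open>s\<^sub>r\<close> is \<open>S ! (r - 1)\<close>.\<close>

definition strategy :: "(nat \<Rightarrow> nat) list \<Rightarrow> bool" where
  "strategy S \<longleftrightarrow> (\<forall>i\<in>{1..length S}. S ! (i - 1) permutes {1..i})"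

definition incorrect :: "nat \<Rightarrow> (nat \<Rightarrow> nat) \<Rightarrow> (nat \<Rightarrow> nat) \<Rightarrow> nat set" where
  "incorrect n p \<gamma> = {m \<in> {1..n}. \<gamma> m \<noteq> p m}"

text \<open>
  With \<open>I = {P\<^sub>1 < \<dots> < P\<^sub>r}\<close>, the entry at an incorrect position \<open>m\<close> of the next guess is
  \<open>\<gamma> P\<^sub>i\<close> for the unique \<open>i\<close> with \<open>P\<^bsub>s\<^sub>r(i)\<^esub> = m\<close>; see \<open>next_guess_incorrect\<close> below.
\<close>

definition next_guess :: "(nat \<Rightarrow> nat) list \<Rightarrow> (nat \<Rightarrow> nat) \<Rightarrow> (nat \<Rightarrow> nat) \<Rightarrow> nat \<Rightarrow> nat" where
  "next_guess S p \<gamma> m =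
    (let I = incorrect (length S) p \<gamma>; r = card I; s = S ! (r - 1)
     in if m \<in> I
        then \<gamma> (nth_least I (inv_into {1..r} (\<lambda>i. nth_least I (s i)) m))
        else \<gamma> m)"

text \<open>\<open>guess S p k\<close> is the guess \<open>\<gamma>\<^bsub>k+1\<^esub>\<close>; it is only played if the game has not ended before.\<close>

primrec guess :: "(nat \<Rightarrow> nat) list \<Rightarrow> (nat \<Rightarrow> nat) \<Rightarrow> nat \<Rightarrow> nat \<Rightarrow> nat" where
  "guess S p 0 = id"
| "guess S p (Suc k) = next_guess S p (guess S p k)"

definition played :: "(nat \<Rightarrow> nat) list \<Rightarrow> (nat \<Rightarrow> nat) \<Rightarrow> nat \<Rightarrow> bool" where
  "played S p k \<longleftrightarrow> (\<forall>j<k. incorrect (length S) p (guess S p j) \<noteq> {})"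

definition repeats_incorrect :: "(nat \<Rightarrow> nat) list \<Rightarrow> (nat \<Rightarrow> nat) \<Rightarrow> bool" where
  "repeats_incorrect S p \<longleftrightarrow>
    (\<exists>s t m. s < t \<and> played S p t \<and> m \<in> incorrect (length S) p (guess S p s) \<and>
             guess S p s m = guess S p t m)"

definition offending :: "(nat \<Rightarrow> nat) list \<Rightarrow> (nat \<Rightarrow> nat) \<Rightarrow> bool" where
  "offending S \<omega> \<longleftrightarrow> \<omega> permutes {1..length S} \<and> repeats_incorrect S \<omega>"

text \<open>The permutation \<open>[2, 3, \<dots>, k, 1]\<close> of \<open>[k]\<close>.\<close>

definition shift_perm :: "nat \<Rightarrow> nat \<Rightarrow> nat" where
  "shift_perm k i = (if i \<in> {1..k} then (if i = k then 1 else i + 1) else i)"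

definition inductive_strategy :: "nat \<Rightarrow> (nat \<Rightarrow> nat) \<Rightarrow> (nat \<Rightarrow> nat) list" where
  "inductive_strategy n \<sigma> = map shift_perm [1..<n] @ [\<sigma>]"

definition min_disp :: "nat list \<Rightarrow> nat" where
  "min_disp D = Min (set D - {1})"

definition min_disp_pos :: "nat list \<Rightarrow> nat" where
  "min_disp_pos D = Min {x \<in> {1..length D}. D ! (x - 1) = min_disp D}"

definition kept_positions :: "nat list \<Rightarrow> nat set" where
  "kept_positions D = {wrap (length D) (min_disp_pos D + k) | k. 1 \<le> k \<and> k \<le> min_disp D - 1}"

text \<open>
  A position \<open>x\<close> in the complement \<open>L\<close> of \<open>K\<close> receives the value \<open>\<sigma>\<^sup>-\<^sup>1[L[j]]\<close> for the unique
  \<open>j\<close> with \<open>x = L[j + 2]\<close>, indices modulo \<open>m\<close>; see \<open>omega_moved\<close> below.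
\<close>

definition omega :: "nat \<Rightarrow> (nat \<Rightarrow> nat) \<Rightarrow> nat \<Rightarrow> nat" where
  "omega n \<sigma> x =
    (let K = kept_positions (displacement n (inv \<sigma>)); L = {1..n} - K; m = card L
     in if x \<in> K then inv \<sigma> x
        else if x \<in> L
        then inv \<sigma> (nth_least L (inv_into {1..m} (\<lambda>j. nth_least L (wrap m (j + 2))) x))
        else x)"

lemma inj_on_nth_least: "finite A \<Longrightarrow> inj_on (nth_least A) {1..card A}"
  by (auto simp: inj_on_def nth_least_def nth_eq_iff_index_eq)

lemma nth_least_mem:
  assumes "finite A" "i \<in> {1..card A}"
  shows "nth_least A i \<in> A"
proof -
  have "sorted_list_of_set A ! (i - 1) \<in> set (sorted_list_of_set A)"
    using assms by (intro nth_mem) auto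
  then show ?thesis using assms by (simp add: nth_least_def)
qed

lemma wrap_mem: "m > 0 \<Longrightarrow> wrap m x \<in> {1..m}"
  by (simp add: wrap_def Suc_le_eq)

lemma inj_on_wrap_add: "inj_on (\<lambda>j. wrap m (j + c)) {1..m}"
proof (rule inj_onI)
  fix i j assume ij: "i \<in> {1..m}" "j \<in> {1..m}" and eq: "wrap m (i + c) = wrap m (j + c)"
  have *: "k + c - 1 = (k - 1) + c" if "k \<in> {1..m}" for k using that by auto
  have "((i - 1) + c) mod m = ((j - 1) + c) mod m"
    using eq *[OF ij(1)] *[OF ij(2)] by (simp add: wrap_def)
  then have "int ((i - 1) + c) mod int m = int ((j - 1) + c) mod int m"
    by (metis zmod_int)
  then have "(int ((i - 1) + c) - int c) mod int m = (int ((j - 1) + c) - int c) mod int m"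
    by (rule mod_diff_cong) simp
  then have "(i - 1) mod m = (j - 1) mod m"
    by (metis add_diff_cancel_right' of_nat_add of_nat_eq_iff zmod_int)
  then show "i = j" using ij by auto
qed

lemma strategy_inductive:
  assumes "\<sigma> permutes {1..n}" "n \<ge> 1"
  shows "strategy (inductive_strategy n \<sigma>)" "length (inductive_strategy n \<sigma>) = n"
proof -
  have "shift_perm k permutes {1..k}" for k
  proof (rule bij_imp_permutes)
    have "inj_on (shift_perm k) {1..k}"
      by (auto simp: inj_on_def shift_perm_def split: if_splits)
    moreover have "shift_perm k ` {1..k} \<subseteq> {1..k}"
      by (auto simp: shift_perm_def)
    ultimately show "bij_betw (shift_perm k) {1..k} {1..k}"
      by (simp add: bij_betw_def endo_inj_surj)
  qed (auto simp: shift_perm_def)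
  then show "strategy (inductive_strategy n \<sigma>)"
    using assms by (auto simp: strategy_def inductive_strategy_def nth_append not_less
        dest!: le_antisym)
  show "length (inductive_strategy n \<sigma>) = n"
    using assms by (simp add: inductive_strategy_def)
qed

lemma next_guess_correct:
  "m \<notin> incorrect (length S) p \<gamma> \<Longrightarrow> next_guess S p \<gamma> m = \<gamma> m"
  by (simp add: next_guess_def)

lemma next_guess_incorrect:
  fixes S p \<gamma>
  defines "I \<equiv> incorrect (length S) p \<gamma>"
  defines "s \<equiv> S ! (card I - 1)"
  assumes "strategy S" and i: "i \<in> {1..card I}"
  shows "next_guess S p \<gamma> (nth_least I (s i)) = \<gamma> (nth_least I i)"
proof -
  have fin: "finite I" by (simp add: I_def incorrect_def)
  have "card I \<le> card {1..length S}"
    unfolding I_def incorrect_def by (intro card_mono) auto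
  then have s: "s permutes {1..card I}"
    using assms(3) i unfolding s_def strategy_def by auto
  have "inj_on (nth_least I \<circ> s) {1..card I}"
    using s inj_on_nth_least[OF fin] by (intro comp_inj_on) (auto simp: permutes_inj_on permutes_image)
  then have "inv_into {1..card I} (\<lambda>i. nth_least I (s i)) (nth_least I (s i)) = i"
    using inv_into_f_f[OF _ i] by (fastforce simp: comp_def)
  moreover have "nth_least I (s i) \<in> I"
    using nth_least_mem[OF fin] permutes_in_image[OF s] i by blast
  ultimately show ?thesis
    unfolding next_guess_def Let_def I_def[symmetric] s_def[symmetric] by simp
qed

lemma omega_kept:
  "i \<in> kept_positions (displacement n (inv \<sigma>)) \<Longrightarrow> omega n \<sigma> i = inv \<sigma> i"
  by (simp add: omega_def)

lemma omega_moved: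
  fixes n \<sigma>
  defines "L \<equiv> {1..n} - kept_positions (displacement n (inv \<sigma>))"
  defines "m \<equiv> card L"
  assumes j: "j \<in> {1..m}"
  shows "omega n \<sigma> (nth_least L (wrap m (j + 2))) = inv \<sigma> (nth_least L j)"
proof -
  have fin: "finite L" by (simp add: L_def)
  have m: "m > 0" using j by simp
  have "inj_on (nth_least L \<circ> (\<lambda>j. wrap m (j + 2))) {1..m}"
    using inj_on_nth_least[OF fin] wrap_mem[OF m] unfolding m_def
    by (intro comp_inj_on inj_on_wrap_add) (auto intro: inj_on_subset)
  then have "inv_into {1..m} (\<lambda>j. nth_least L (wrap m (j + 2))) (nth_least L (wrap m (j + 2))) = j"
    using inv_into_f_f[OF _ j] by (fastforce simp: comp_def)
  moreover have "nth_least L (wrap m (j + 2)) \<in> L"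
    using nth_least_mem[OF fin] wrap_mem[OF m] unfolding m_def by blast
  ultimately show ?thesis
    unfolding omega_def Let_def L_def[symmetric] m_def[symmetric]
    by (simp add: L_def)
qed

end

theory Submission
  imports Defs
begin

text \<open>
  Write \<open>\<tau> = \<sigma>\<^sup>-\<^sup>1\<close>. If the first guess, the identity, is wrong everywhere, then \<open>s\<^sub>n = \<sigma>\<close> makes
  the second guess \<open>\<tau>\<close>. The secret \<open>\<omega>\<close> agrees with \<open>\<tau>\<close> on \<open>K\<close> and is \<open>\<tau>\<close> moved two places
  along the cyclically ordered complement \<open>L\<close>, so exactly the positions in \<open>L\<close> stay wrong.
  As \<open>1 \<le> |L| < n\<close>, the strategy now applies \<open>[2, \<dots>, m, 1]\<close>, so the third guess is \<open>\<tau>\<close> moved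
  one place along \<open>L\<close>. The set \<open>K\<close> is the open cyclic interval from \<open>\<iota>\<close> to
  \<open>\<tau> \<iota> = \<iota> + \<mu>\<close>; deleting it makes \<open>\<iota> + \<mu>\<close> the cyclic successor of \<open>\<iota>\<close> in \<open>L\<close>. Hence the
  third guess puts the value \<open>\<tau> \<iota> = \<iota> + \<mu>\<close> at the position \<open>\<iota> + \<mu>\<close>, as the first, wrong, guess did.

  What needs care is that the first guess really is wrong everywhere, that is, that \<open>\<omega>\<close> has no
  fixed point (lemma \<open>\<omega>_neq\<close>). On \<open>K\<close> this holds because \<open>\<tau>\<close> is a derangement. On \<open>L\<close> a fixed
  point means that \<open>\<tau>\<close> sends some \<open>x\<close> two places ahead along \<open>L\<close>. If the two places do not
  cross \<open>K\<close>, then \<open>\<tau>\<close> has displacement 2 at \<open>x\<close>, which is excluded. Only \<open>x = \<iota> - 1\<close> and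
  \<open>x = \<iota>\<close> cross \<open>K\<close>; they would be sent to \<open>\<iota> + \<mu>\<close> and \<open>\<iota> + \<mu> + 1\<close>, and neither is
  possible since \<open>\<tau>\<close> is injective and \<open>\<tau> \<iota> = \<iota> + \<mu>\<close>. The entry of \<open>D\<close> in \<open>{3..n - 2}\<close> yields \<open>\<mu> \<le> n - 2\<close>,
  so \<open>L\<close> has at least three elements and moving by two places along it fixes none of them; this
  is why no position in \<open>L\<close> is correct in the second guess.

  To do this arithmetic, positions are counted cyclically from \<open>\<iota>\<close>: \<open>pos c\<close> is the position \<open>\<iota> + c\<close>
  modulo \<open>n\<close>, so that \<open>K\<close> and \<open>L\<close> are the images of the intervals \<open>{1..<\<mu>}\<close> and \<open>{\<mu>..n}\<close>.
  The game and \<open>\<omega>\<close> speak of ranks in \<open>L\<close> instead; lemma \<open>nth_least_cyclic_next\<close>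
  translates the step to the next rank into the step to the next position on the cycle.
\<close>

section \<open>Cyclic arithmetic and ranks\<close>

lemma wrap_id: "x \<in> {1..n} \<Longrightarrow> wrap n x = x"
  by (auto simp: wrap_def)

lemma wrap_add_period: "x \<ge> 1 \<Longrightarrow> wrap n (x + n) = wrap n x"
  by (simp add: wrap_def flip: Nat.add_diff_assoc2)

lemma wrap_wrap_add:
  assumes "a \<ge> 1"
  shows "wrap n (wrap n a + b) = wrap n (a + b)"
proof -
  have "((a - 1) mod n + b) mod n = ((a - 1) + b) mod n"
    by (simp add: mod_add_left_eq)
  then show ?thesis using assms by (simp add: wrap_def)
qed

lemma inj_on_wrap_add_left: "inj_on (\<lambda>c. wrap n (a + c)) {1..n}"
  using inj_on_wrap_add[of n a] by (simp add: add.commute)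

lemma wrap_add_displacement:
  assumes "x \<in> {1..n}" "y \<in> {1..n}"
  shows "wrap n (x + nat ((int y - int x) mod int n)) = y"
proof -
  define d where "d = nat ((int y - int x) mod int n)"
  have d: "int d = (int y - int x) mod int n" using assms by (simp add: d_def)
  have "int ((x + d - 1) mod n) = (int x - 1 + int d) mod int n"
    using assms by (simp add: zmod_int of_nat_diff algebra_simps)
  also have "\<dots> = (int x - 1 + (int y - int x)) mod int n"
    unfolding d by (rule mod_add_right_eq)
  also have "\<dots> = int (y - 1)" using assms by (simp add: of_nat_diff)
  finally have "(x + d - 1) mod n = y - 1" by simp
  then show ?thesis using assms by (simp add: wrap_def d_def)
qed

lemma displacement_nth:
  assumes "x \<in> {1..n}"
  shows "displacement n \<pi> ! (x - 1) = nat ((int (\<pi> x) - int x) mod int n)"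
  using assms by (subst displacement_def, subst nth_map) (auto simp del: upt_Suc)

lemma length_displacement: "length (displacement n \<pi>) = n"
  by (simp add: displacement_def)

lemma displacement_in_set:
  assumes "x \<in> {1..n}" "\<pi> x = wrap n (x + d)" "d < n"
  shows "d \<in> set (displacement n \<pi>)"
proof -
  have "int (wrap n (x + d)) = (int x - 1 + int d) mod int n + 1"
    using assms by (simp add: wrap_def zmod_int of_nat_diff algebra_simps)
  then have "int (\<pi> x) - int x = (int x - 1 + int d) mod int n - (int x - 1)"
    using assms by simp
  then have "(int (\<pi> x) - int x) mod int n = (int x - 1 + int d - (int x - 1)) mod int n"
    by (simp only: mod_diff_left_eq)
  then have "(int (\<pi> x) - int x) mod int n = int d"
    using assms(3) by simp
  then show ?thesis
    using assms by (force simp: displacement_def simp del: upt_Suc)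
qed

lemma nth_least_less:
  assumes "finite A" "i \<in> {1..card A}" "j \<in> {1..card A}" "i < j"
  shows "nth_least A i < nth_least A j"
  unfolding nth_least_def using assms
  by (intro sorted_wrt_nth_less[OF strict_sorted_list_of_set]) auto

lemma nth_least_cases:
  assumes "finite A" "x \<in> A"
  obtains i where "i \<in> {1..card A}" "x = nth_least A i"
proof -
  have "x \<in> set (sorted_list_of_set A)" using assms by simp
  then obtain k where k: "k < card A" "sorted_list_of_set A ! k = x"
    by (metis in_set_conv_nth length_sorted_list_of_set)
  show ?thesis by (rule that[of "Suc k"]) (use k in \<open>auto simp: nth_least_def\<close>)
qed

lemma card_le_nth_least:
  assumes "finite A" "i \<in> {1..card A}"
  shows "card {y \<in> A. y \<le> nth_least A i} = i"
proof -
  have "{y \<in> A. y \<le> nth_least A i} = nth_least A ` {1..i}"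
  proof (intro set_eqI iffI)
    fix y assume y: "y \<in> {y \<in> A. y \<le> nth_least A i}"
    then obtain j where j: "j \<in> {1..card A}" "y = nth_least A j"
      using nth_least_cases assms(1) by blast
    then have "j \<le> i" using nth_least_less[OF assms j(1)] y by (force simp: not_le)
    then show "y \<in> nth_least A ` {1..i}" using j by auto
  next
    fix y assume "y \<in> nth_least A ` {1..i}"
    then obtain j where j: "j \<in> {1..i}" "y = nth_least A j" by auto
    then have j': "j \<in> {1..card A}" using assms by auto
    show "y \<in> {y \<in> A. y \<le> nth_least A i}"
      using nth_least_less[OF assms(1) j' assms(2)] nth_least_mem[OF assms(1) j'] j
      by (cases "j = i") auto
  qed
  moreover have "inj_on (nth_least A) {1..i}"
    using inj_on_nth_least[OF assms(1)] by (rule inj_on_subset) (use assms in auto)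
  ultimately show ?thesis by (simp add: card_image)
qed

lemma nth_least_card_le:
  assumes "finite A" "x \<in> A"
  shows "nth_least A (card {y \<in> A. y \<le> x}) = x"
proof -
  obtain i where "i \<in> {1..card A}" "x = nth_least A i" using nth_least_cases[OF assms] .
  then show ?thesis using card_le_nth_least[OF assms(1)] by simp
qed

text \<open>
  Raising the rank by one, modulo \<open>card L\<close>, means walking around the cycle of length \<open>n\<close> up to
  the next element of \<open>L\<close>. If the walk does not pass \<open>n\<close>, one more element of \<open>L\<close> lies at or
  below the end point than below the start; if it does, the start is the largest and the end the
  smallest element of \<open>L\<close>. The end may equal the start (\<open>d = n\<close>), when \<open>L\<close> is a singleton.
\<close>

lemma nth_least_cyclic_next:
  assumes L: "L \<subseteq> {1..n}" and i: "i \<in> {1..card L}" and d: "1 \<le> d" "d \<le> n"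
    and gap: "\<And>k. 1 \<le> k \<Longrightarrow> k < d \<Longrightarrow> wrap n (nth_least L i + k) \<notin> L"
    and next_mem: "wrap n (nth_least L i + d) \<in> L"
  shows "nth_least L (wrap (card L) (i + 1)) = wrap n (nth_least L i + d)"
proof -
  define x where "x = nth_least L i"
  define y where "y = wrap n (x + d)"
  have fin: "finite L" using L finite_subset by blast
  have x: "x \<in> L" using nth_least_mem[OF fin i] by (simp add: x_def)
  have xn: "1 \<le> x" "x \<le> n" using x L by auto
  have y: "y \<in> L" using next_mem by (simp add: y_def x_def)
  have rank_x: "card {z \<in> L. z \<le> x} = i"
    using card_le_nth_least[OF fin i] by (simp add: x_def)
  have "card {z \<in> L. z \<le> y} = wrap (card L) (i + 1)"
  proof (cases "x + d \<le> n")
    case True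
    have y_eq: "y = x + d" unfolding y_def using True xn by (intro wrap_id) auto
    have "z \<le> x" if "z \<in> L" "z \<le> y" "z \<noteq> y" for z
    proof (rule ccontr)
      assume "\<not> z \<le> x"
      moreover from this have "wrap n (x + (z - x)) = z"
        using that L wrap_id[of z n] by auto
      ultimately show False using gap[of "z - x"] that d y_eq x_def by force
    qed
    then have "{z \<in> L. z \<le> y} = insert y {z \<in> L. z \<le> x}"
      using y y_eq by auto
    then have "card {z \<in> L. z \<le> y} = i + 1"
      using rank_x fin y_eq d by simp
    moreover have "card {z \<in> L. z \<le> y} \<le> card L" using fin by (intro card_mono) auto
    ultimately show ?thesis by (simp add: wrap_id)
  next
    case False
    have "y = wrap n ((x + d - n) + n)" unfolding y_def using False by simp
    also have "\<dots> = wrap n (x + d - n)" using False by (intro wrap_add_period) auto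
    also have "\<dots> = x + d - n" using False xn d by (intro wrap_id) auto
    finally have y_eq: "y = x + d - n" .
    have above: "z \<le> x" if "z \<in> L" for z
    proof (rule ccontr)
      assume "\<not> z \<le> x"
      have zn: "z \<in> {1..n}" using that L by blast
      then have "wrap n (x + (z - x)) = z" using wrap_id[of z n] \<open>\<not> z \<le> x\<close> by simp
      moreover have "1 \<le> z - x" "z - x < d" using False zn \<open>\<not> z \<le> x\<close> by auto
      ultimately show False using gap[of "z - x"] that by (simp add: x_def)
    qed
    have below: "y \<le> z" if "z \<in> L" for z
    proof (rule ccontr)
      assume "\<not> y \<le> z"
      \<comment> \<open>walking from \<open>x\<close> past \<open>n\<close>, such a \<open>z\<close> would be met after \<open>z + n - x < d\<close> steps\<close>
      have zn: "1 \<le> z" "z \<le> n" using that L by auto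
      have "wrap n (x + (z + n - x)) = wrap n (z + n)" using xn by simp
      also have "\<dots> = z" using zn by (simp add: wrap_add_period wrap_id)
      finally have "wrap n (x + (z + n - x)) = z" .
      moreover have "1 \<le> z + n - x" "z + n - x < d" using \<open>\<not> y \<le> z\<close> zn xn y_eq by auto
      ultimately show False using gap[of "z + n - x"] that by (simp add: x_def)
    qed
    have "{z \<in> L. z \<le> x} = L" using above by blast
    then have "i = card L" using rank_x by simp
    moreover have "{z \<in> L. z \<le> y} = {y}" using below y by force
    ultimately show ?thesis by (simp add: wrap_def)
  qed
  then show ?thesis using nth_least_card_le[OF fin y] by (simp add: y_def x_def)
qed

section \<open>Guesses of the inductive strategy\<close>

lemma inductive_strategy_nth:
  "1 \<le> r \<Longrightarrow> r < n \<Longrightarrow> inductive_strategy n \<sigma> ! (r - 1) = shift_perm r"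
  "inductive_strategy n \<sigma> ! (n - 1) = \<sigma>"
  by (auto simp: inductive_strategy_def nth_append)

lemma shift_perm_eq_wrap: "i \<in> {1..k} \<Longrightarrow> shift_perm k i = wrap k (i + 1)"
  by (auto simp: shift_perm_def wrap_def)

lemma nth_least_interval: "i \<in> {1..n} \<Longrightarrow> nth_least {1..n} i = i"
proof -
  assume i: "i \<in> {1..n}"
  have "{y \<in> {1..n}. y \<le> i} = {1..i}" using i by auto
  then show ?thesis using nth_least_card_le[of "{1..n}" i] i by simp
qed

lemma second_guess:
  assumes \<sigma>: "\<sigma> permutes {1..n}" and x: "x \<in> {1..n}"
    and wrong: "\<And>z. z \<in> {1..n} \<Longrightarrow> p z \<noteq> z"
  shows "guess (inductive_strategy n \<sigma>) p 1 x = inv \<sigma> x"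
proof -
  let ?S = "inductive_strategy n \<sigma>"
  have n: "n \<ge> 1" using x by auto
  note S = strategy_inductive[OF \<sigma> n]
  have I: "incorrect (length ?S) p id = {1..n}"
    using wrong unfolding incorrect_def S(2) by force
  have i: "inv \<sigma> x \<in> {1..n}" using permutes_in_image[OF permutes_inv[OF \<sigma>]] x by blast
  have "next_guess ?S p id (nth_least {1..n} (\<sigma> (inv \<sigma> x))) = id (nth_least {1..n} (inv \<sigma> x))"
    using next_guess_incorrect[OF S(1), of "inv \<sigma> x" p id] i
    unfolding I by (simp add: inductive_strategy_nth(2)[unfolded One_nat_def])
  then show ?thesis
    using nth_least_interval[OF x] nth_least_interval[OF i] permutes_inverses(1)[OF \<sigma>] by simp
qed

section \<open>The permutation \<omega>\<close>

locale omega_construction =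
  fixes n :: nat and \<sigma> :: "nat \<Rightarrow> nat"
  assumes derangement: "derangement n \<sigma>"
    and no_two: "2 \<notin> set (displacement n (inv \<sigma>))"
    and middle: "\<exists>d \<in> set (displacement n (inv \<sigma>)). d \<in> {3..n - 2}"
begin

abbreviation "D \<equiv> displacement n (inv \<sigma>)"
abbreviation "\<tau> \<equiv> inv \<sigma>"
abbreviation "\<omega> \<equiv> omega n \<sigma>"
abbreviation "\<mu> \<equiv> min_disp D"
abbreviation "\<iota> \<equiv> min_disp_pos D"

definition L :: "nat set" where
  "L = {1..n} - kept_positions D"

text \<open>
  Counting from \<open>\<iota>\<close> turns the cyclic intervals \<open>K\<close> and \<open>L\<close> into intervals of naturals. The index
  runs through \<open>{1..n}\<close>, so that \<open>\<iota>\<close> itself is \<open>pos n\<close>, the last element of \<open>L\<close> before \<open>K\<close>.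
\<close>

definition pos :: "nat \<Rightarrow> nat" where
  "pos c = wrap n (\<iota> + c)"

lemma \<sigma>_permutes: "\<sigma> permutes {1..n}"
  using derangement by (simp add: derangement_def)

lemma \<tau>_permutes: "\<tau> permutes {1..n}"
  by (rule permutes_inv[OF \<sigma>_permutes])

lemma \<tau>_neq: "x \<in> {1..n} \<Longrightarrow> \<tau> x \<noteq> x"
  using derangement permutes_inverses(1)[OF \<sigma>_permutes] by (metis derangement_def)

lemma \<tau>_eq_iff [simp]: "\<tau> x = \<tau> y \<longleftrightarrow> x = y"
  using permutes_inj[OF \<tau>_permutes] by (simp add: inj_eq)

lemma zero_notin: "0 \<notin> set D"
proof
  assume "0 \<in> set D"
  then obtain k where k: "k < n" "D ! k = 0"
    by (auto simp: in_set_conv_nth length_displacement)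
  then have x: "Suc k \<in> {1..n}" by auto
  then have "\<tau> (Suc k) \<in> {1..n}" using permutes_in_image[OF \<tau>_permutes] by blast
  then have "wrap n (Suc k + D ! k) = \<tau> (Suc k)"
    using wrap_add_displacement[OF x] displacement_nth[OF x] by simp
  then show False using k \<tau>_neq[OF x] wrap_id[OF x] by simp
qed

lemma \<mu>_bounds: "3 \<le> \<mu>" "\<mu> + 2 \<le> n" and \<mu>_mem: "\<mu> \<in> set D"
proof -
  obtain d where d: "d \<in> set D" "3 \<le> d" "d \<le> n - 2" using middle by auto
  have fin: "finite (set D - {1})" by simp
  have "\<mu> \<in> set D - {1}" unfolding min_disp_def by (rule Min_in[OF fin]) (use d in auto)
  then show "\<mu> \<in> set D" "3 \<le> \<mu>"
    using zero_notin no_two by (force, cases "\<mu> = 0 \<or> \<mu> = 2") auto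
  have "\<mu> \<le> d" unfolding min_disp_def by (rule Min_le[OF fin]) (use d in auto)
  then show "\<mu> + 2 \<le> n" using d by simp
qed

lemma \<iota>_mem: "\<iota> \<in> {1..n}" and \<tau>_\<iota>: "\<tau> \<iota> = pos \<mu>"
proof -
  let ?X = "{x \<in> {1..length D}. D ! (x - 1) = \<mu>}"
  obtain k where "k < n" "D ! k = \<mu>"
    using \<mu>_mem by (auto simp: in_set_conv_nth length_displacement)
  then have "Suc k \<in> ?X" by (simp add: length_displacement)
  then have "\<iota> \<in> ?X" unfolding min_disp_pos_def by (intro Min_in) auto
  then show \<iota>: "\<iota> \<in> {1..n}" and "\<tau> \<iota> = pos \<mu>"
    using wrap_add_displacement[of \<iota> n "\<tau> \<iota>"] displacement_nth[of \<iota> n \<tau>]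
      permutes_in_image[OF \<tau>_permutes, of \<iota>]
    by (auto simp: pos_def length_displacement)
qed

lemma bij_pos: "bij_betw pos {1..n} {1..n}"
proof -
  have "inj_on pos {1..n}" unfolding pos_def by (rule inj_on_wrap_add_left)
  moreover have "pos ` {1..n} \<subseteq> {1..n}"
    using wrap_mem[of n] \<mu>_bounds unfolding pos_def by (intro image_subsetI) simp
  ultimately show ?thesis by (simp add: bij_betw_def endo_inj_surj)
qed

lemma pos_eq_iff: "a \<in> {1..n} \<Longrightarrow> b \<in> {1..n} \<Longrightarrow> pos a = pos b \<longleftrightarrow> a = b"
  using bij_pos inj_on_eq_iff unfolding bij_betw_def by metis

lemma pos_n: "pos n = \<iota>"
  unfolding pos_def using \<iota>_mem by (simp add: wrap_add_period wrap_id)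

lemma wrap_pos_add: "wrap n (pos c + k) = pos (c + k)"
  using \<iota>_mem by (simp add: pos_def wrap_wrap_add add.assoc)

lemma K_eq: "kept_positions D = pos ` {1..<\<mu>}"
proof -
  have "kept_positions D = {pos k | k. 1 \<le> k \<and> k \<le> \<mu> - 1}"
    by (simp add: kept_positions_def length_displacement pos_def)
  also have "\<dots> = pos ` {k. 1 \<le> k \<and> k \<le> \<mu> - 1}" by blast
  also have "{k. 1 \<le> k \<and> k \<le> \<mu> - 1} = {1..<\<mu>}" using \<mu>_bounds by auto
  finally show ?thesis .
qed

lemma finite_L: "finite L" and L_subset: "L \<subseteq> {1..n}"
  by (auto simp: L_def)

lemma L_eq: "L = pos ` {\<mu>..n}"
proof -
  have "L = pos ` {1..n} - pos ` {1..<\<mu>}"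
    using bij_pos by (simp add: L_def K_eq bij_betw_def)
  also have "\<dots> = pos ` ({1..n} - {1..<\<mu>})"
    using bij_pos \<mu>_bounds by (intro inj_on_image_set_diff[symmetric]) (auto simp: bij_betw_def)
  also have "{1..n} - {1..<\<mu>} = {\<mu>..n}" using \<mu>_bounds by auto
  finally show ?thesis .
qed

lemma pos_in_L: "c \<in> {\<mu>..n} \<Longrightarrow> pos c \<in> L"
  unfolding L_eq by blast

lemma card_L: "card L \<in> {1..<n}"
proof -
  have "inj_on pos {\<mu>..n}"
    using bij_pos \<mu>_bounds by (auto simp: bij_betw_def intro: inj_on_subset)
  then have "card L = n + 1 - \<mu>" by (simp add: L_eq card_image)
  then show ?thesis using \<mu>_bounds by auto
qed

text \<open>
  In the order of ranks in \<open>L\<close>, the successor of \<open>pos c\<close> is \<open>pos (c + 1)\<close> for \<open>c < n\<close>, and the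
  successor of \<open>\<iota> = pos n\<close> lies on the other side of \<open>K\<close>.
\<close>

lemma L_step:
  assumes "j \<in> {1..card L}" "nth_least L j = pos c" "c \<in> {\<mu>..<n}"
  shows "nth_least L (wrap (card L) (j + 1)) = pos (c + 1)"
proof -
  have "wrap n (nth_least L j + 1) = pos (c + 1)" by (simp only: assms(2) wrap_pos_add)
  moreover have "pos (c + 1) \<in> L" by (rule pos_in_L) (use assms(3) in auto)
  ultimately show ?thesis
    using nth_least_cyclic_next[OF L_subset assms(1), of 1] \<mu>_bounds by auto
qed

lemma L_jump:
  assumes "j \<in> {1..card L}" "nth_least L j = \<iota>"
  shows "nth_least L (wrap (card L) (j + 1)) = pos \<mu>"
proof -
  have "wrap n (\<iota> + k) \<notin> L" if "1 \<le> k" "k < \<mu>" for k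
    using that K_eq by (auto simp: L_def pos_def)
  moreover have "wrap n (\<iota> + \<mu>) \<in> L" using pos_in_L[of \<mu>] \<mu>_bounds by (simp add: pos_def)
  ultimately show ?thesis
    using nth_least_cyclic_next[OF L_subset, of j \<mu>] assms \<mu>_bounds by (simp add: pos_def)
qed

lemma pos_rank:
  assumes "c \<in> {\<mu>..n}"
  obtains j where "j \<in> {1..card L}" "nth_least L j = pos c"
  using nth_least_cases[OF finite_L pos_in_L[OF assms]] by metis

text \<open>
  Splitting the shift by two into two single steps lets \<open>L_step\<close> and \<open>L_jump\<close> be combined in each
  of the three ways to move two places ahead: staying on one side of \<open>K\<close>, or crossing it
  with the second or with the first step.
\<close>

lemma \<omega>_two_steps:
  assumes "j \<in> {1..card L}"
  shows "\<omega> (nth_least L (wrap (card L) (wrap (card L) (j + 1) + 1))) = \<tau> (nth_least L j)"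
proof -
  have "wrap (card L) (wrap (card L) (j + 1) + 1) = wrap (card L) (j + 2)"
    by (subst wrap_wrap_add) auto
  then show ?thesis using omega_moved[of j n \<sigma>] assms by (simp only: L_def)
qed

lemma wrap_card_L: "wrap (card L) x \<in> {1..card L}"
  using card_L by (intro wrap_mem) auto

lemma \<omega>_pos_add_2:
  assumes "c \<in> {\<mu>..n - 2}"
  shows "\<omega> (pos (c + 2)) = \<tau> (pos c)"
proof -
  have c: "c \<in> {\<mu>..n}" "c \<in> {\<mu>..<n}" "c + 1 \<in> {\<mu>..<n}" using assms \<mu>_bounds by auto
  obtain j where j: "j \<in> {1..card L}" "nth_least L j = pos c" using pos_rank[OF c(1)] .
  show ?thesis
    using L_step[OF wrap_card_L L_step[OF j c(2)] c(3)] \<omega>_two_steps[OF j(1)] j(2) by simp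
qed

lemma \<omega>_pos_\<mu>: "\<omega> (pos \<mu>) = \<tau> (pos (n - 1))"
proof -
  have c: "n - 1 \<in> {\<mu>..n}" "n - 1 \<in> {\<mu>..<n}" using \<mu>_bounds by auto
  obtain j where j: "j \<in> {1..card L}" "nth_least L j = pos (n - 1)" using pos_rank[OF c(1)] .
  have "nth_least L (wrap (card L) (j + 1)) = \<iota>"
    using L_step[OF j c(2)] \<mu>_bounds by (simp add: pos_n)
  from L_jump[OF wrap_card_L this] show ?thesis using \<omega>_two_steps[OF j(1)] j(2) by simp
qed

lemma \<omega>_pos_Suc_\<mu>: "\<omega> (pos (\<mu> + 1)) = \<tau> \<iota>"
proof -
  obtain j where j: "j \<in> {1..card L}" "nth_least L j = \<iota>"
    using pos_rank[of n] \<mu>_bounds pos_n by auto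
  have "\<mu> \<in> {\<mu>..<n}" using \<mu>_bounds by auto
  from L_step[OF wrap_card_L L_jump[OF j] this] show ?thesis
    using \<omega>_two_steps[OF j(1)] j(2) by simp
qed

lemma L_cases [consumes 1, case_names first second later]:
  assumes "x \<in> L"
  obtains "x = pos \<mu>" | "x = pos (\<mu> + 1)"
    | c where "c \<in> {\<mu>..n - 2}" "x = pos (c + 2)"
proof -
  obtain c where c: "c \<in> {\<mu>..n}" "x = pos c" using assms unfolding L_eq by blast
  consider "c = \<mu>" | "c = \<mu> + 1" | "c - 2 \<in> {\<mu>..n - 2}" "c - 2 + 2 = c"
    using c(1) by force
  then show ?thesis
  proof cases
    case 3
    then show ?thesis using that(3)[of "c - 2"] c(2) by simp
  qed (use that(1,2) c(2) in blast)+
qed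

lemma \<omega>_kept: "x \<in> kept_positions D \<Longrightarrow> \<omega> x = \<tau> x"
  by (rule omega_kept)

lemma K_subset: "kept_positions D \<subseteq> {1..n}"
  using bij_pos \<mu>_bounds unfolding K_eq bij_betw_def by auto

text \<open>
  Being defined on a finite set, \<open>\<omega>\<close> only has to be surjective, and \<open>\<omega>\<close> takes the value \<open>\<tau> x\<close>
  at \<open>x\<close> or two places after \<open>x\<close>.
\<close>

lemma \<omega>_permutes: "\<omega> permutes {1..n}"
proof (rule bij_imp_permutes)
  have "\<tau> x \<in> \<omega> ` {1..n}" if "x \<in> {1..n}" for x
  proof (cases "x \<in> kept_positions D")
    case True
    then show ?thesis using \<omega>_kept[OF True] that by (metis imageI)
  next
    case False
    then have "x \<in> L" using that by (simp add: L_def)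
    then obtain c where c: "c \<in> {\<mu>..n}" "x = pos c" unfolding L_eq by blast
    consider "c = n" | "c = n - 1" | "c \<in> {\<mu>..n - 2}" using c(1) by force
    then obtain y where "y \<in> L" "\<omega> y = \<tau> x"
    proof cases
      case 1
      show ?thesis
        by (rule that[of "pos (\<mu> + 1)"])
          (use pos_in_L[of "\<mu> + 1"] \<omega>_pos_Suc_\<mu> \<mu>_bounds 1 c(2) pos_n in auto)
    next
      case 2
      show ?thesis
        by (rule that[of "pos \<mu>"]) (use pos_in_L[of \<mu>] \<omega>_pos_\<mu> \<mu>_bounds 2 c(2) in auto)
    next
      case 3
      show ?thesis
        by (rule that[of "pos (c + 2)"])
          (use pos_in_L[of "c + 2"] \<omega>_pos_add_2[OF 3] \<mu>_bounds 3 c(2) in auto)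
    qed
    then show ?thesis using L_subset by (metis imageI subsetD)
  qed
  then have "{1..n} \<subseteq> \<omega> ` {1..n}"
    by (subst permutes_image[OF \<tau>_permutes, symmetric]) (rule image_subsetI)
  then have eq: "\<omega> ` {1..n} = {1..n}"
    by (intro card_seteq[symmetric] finite_imageI card_image_le) auto
  then have "inj_on \<omega> {1..n}" by (intro eq_card_imp_inj_on) auto
  then show "bij_betw \<omega> {1..n} {1..n}" using eq by (simp add: bij_betw_def)
next
  fix x assume "x \<notin> {1..n}"
  then show "\<omega> x = x" using K_subset by (auto simp: omega_def Let_def)
qed

text \<open>
  A fixed point of \<open>\<omega>\<close> in \<open>L\<close> would be \<open>\<tau>\<close> of the element two places before it: this contradicts
  injectivity of \<open>\<tau>\<close> at \<open>pos \<mu> = \<tau> \<iota>\<close>, the value of \<open>\<tau> \<iota>\<close> at \<open>pos (\<mu> + 1)\<close>, and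
  the absence of displacement 2 elsewhere.
\<close>

lemma \<omega>_neq:
  assumes "x \<in> {1..n}"
  shows "\<omega> x \<noteq> x"
proof (cases "x \<in> kept_positions D")
  case True
  then show ?thesis using \<omega>_kept[OF True] \<tau>_neq[OF assms] by simp
next
  case False
  then have "x \<in> L" using assms by (simp add: L_def)
  then show ?thesis
  proof (cases rule: L_cases)
    case first
    have "pos (n - 1) \<noteq> pos n" using \<mu>_bounds by (subst pos_eq_iff) auto
    then show ?thesis using first \<omega>_pos_\<mu> \<tau>_\<iota> pos_n by (metis \<tau>_eq_iff)
  next
    case second
    have "pos \<mu> \<noteq> pos (\<mu> + 1)" using \<mu>_bounds by (subst pos_eq_iff) auto
    then show ?thesis using second \<omega>_pos_Suc_\<mu> \<tau>_\<iota> by simp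
  next
    case (later c)
    have "pos c \<in> {1..n}" using later(1) pos_in_L[of c] L_subset by force
    then have "\<tau> (pos c) \<noteq> wrap n (pos c + 2)"
      using displacement_in_set[of "pos c" n \<tau> 2] no_two \<mu>_bounds by auto
    then show ?thesis unfolding wrap_pos_add later(2) \<omega>_pos_add_2[OF later(1)] .
  qed
qed

lemma \<omega>_neq_\<tau>:
  assumes "x \<in> L"
  shows "\<omega> x \<noteq> \<tau> x"
  using assms
proof (cases rule: L_cases)
  case first
  have "pos (n - 1) \<noteq> pos \<mu>" using \<mu>_bounds by (subst pos_eq_iff) auto
  then show ?thesis using first \<omega>_pos_\<mu> by simp
next
  case second
  have "pos n \<noteq> pos (\<mu> + 1)" using \<mu>_bounds by (subst pos_eq_iff) auto
  then show ?thesis using second \<omega>_pos_Suc_\<mu> pos_n by simp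
next
  case (later c)
  have "pos c \<noteq> pos (c + 2)" using later(1) \<mu>_bounds by (subst pos_eq_iff) auto
  then show ?thesis using later \<omega>_pos_add_2 by simp
qed

section \<open>The repeated guess\<close>

abbreviation "S \<equiv> inductive_strategy n \<sigma>"

lemma strategy_S: "strategy S" "length S = n"
  using strategy_inductive[OF \<sigma>_permutes] \<mu>_bounds by auto

lemma guess_1: "x \<in> {1..n} \<Longrightarrow> guess S \<omega> 1 x = \<tau> x"
  using second_guess[OF \<sigma>_permutes] \<omega>_neq by blast

lemma incorrect_1: "incorrect (length S) \<omega> (guess S \<omega> 1) = L"
proof -
  have "guess S \<omega> 1 x \<noteq> \<omega> x \<longleftrightarrow> x \<in> L" if "x \<in> {1..n}" for x
  proof -
    have "x \<in> L \<longleftrightarrow> x \<notin> kept_positions D" using that by (auto simp: L_def)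
    then show ?thesis using guess_1[OF that] \<omega>_neq_\<tau>[of x] \<omega>_kept[of x] by metis
  qed
  then show ?thesis unfolding incorrect_def strategy_S(2) using L_subset by blast
qed

text \<open>
  The position after \<open>\<iota>\<close> in \<open>L\<close> is \<open>\<tau> \<iota>\<close>, and it receives the entry of the second guess at \<open>\<iota>\<close>,
  which is \<open>\<tau> \<iota>\<close> as well.
\<close>

lemma guess_2: "guess S \<omega> 2 (pos \<mu>) = pos \<mu>"
proof -
  obtain j where j: "j \<in> {1..card L}" "nth_least L j = \<iota>"
    using pos_rank[of n] \<mu>_bounds pos_n by auto
  have s: "S ! (card L - 1) = shift_perm (card L)"
    using card_L by (intro inductive_strategy_nth) auto
  have "next_guess S \<omega> (guess S \<omega> 1) (nth_least L (shift_perm (card L) j)) = guess S \<omega> 1 \<iota>"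
    using next_guess_incorrect[OF strategy_S(1), of j \<omega> "guess S \<omega> 1"] j
    unfolding incorrect_1 s by simp
  then have "next_guess S \<omega> (guess S \<omega> 1) (pos \<mu>) = \<tau> \<iota>"
    using L_jump[OF j] j(1) guess_1[OF \<iota>_mem] by (simp add: shift_perm_eq_wrap)
  then show ?thesis using \<tau>_\<iota> by (simp add: numeral_2_eq_2)
qed

lemma offending_\<omega>: "offending S \<omega>"
proof -
  have \<mu>: "pos \<mu> \<in> L" using \<mu>_bounds by (intro pos_in_L) auto
  have m: "pos \<mu> \<in> incorrect (length S) \<omega> (guess S \<omega> 0)"
    using \<mu> L_subset \<omega>_neq[of "pos \<mu>"] unfolding incorrect_def strategy_S(2) by force
  have "played S \<omega> 2"
    unfolding played_def
  proof (intro allI impI)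
    fix j :: nat assume "j < 2"
    then consider "j = 0" | "j = 1" by linarith
    then show "incorrect (length S) \<omega> (guess S \<omega> j) \<noteq> {}"
      using m \<mu> incorrect_1 by cases auto
  qed
  moreover have "guess S \<omega> 0 (pos \<mu>) = guess S \<omega> 2 (pos \<mu>)" by (simp add: guess_2)
  ultimately have "repeats_incorrect S \<omega>"
    unfolding repeats_incorrect_def using m by (metis zero_less_numeral)
  then show ?thesis using \<omega>_permutes by (simp add: offending_def strategy_S)
qed

end

theorem proposition5:
  fixes n :: nat and \<sigma> :: "nat \<Rightarrow> nat"
  assumes "derangement n \<sigma>"
    and "2 \<notin> set (displacement n (inv \<sigma>))"
    and "\<exists>d \<in> set (displacement n (inv \<sigma>)). d \<in> {3..n - 2}"
  shows "offending (inductive_strategy n \<sigma>) (omega n \<sigma>)"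
proof -
  interpret omega_construction n \<sigma> using assms by unfold_locales
  show ?thesis by (rule offending_\<omega>)
qed

end
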